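(* For each integer $d\geq 2$, let $\mathcal{C}_d$ denote the set of all closed balls in $\ell_\infty^d$ and let $\mathcal{D}_{d-1}^0$ denote the set of all degenerate balls in $\ell_\infty^{d-1}$ containing the origin $\mathbf{0}$. Then $\mathrm{VC\text{-}dim}(\mathcal{C}_d)=\mathrm{VC\text{-}dim}(\mathcal{D}_{d-1}^0)+2$.
   Context: For $m\ge 1$, $\ell_\infty^m$ denotes $\mathbb{R}^m$ equipped with the norm $\|\mathbf{x}\|_\infty=\max\{|x_1|,\dots,|x_m|\}$. The closed balls (of positive finite radius) in $\ell_\infty^m$ are exactly the closed cubes with sides parallel to the coordinate axes, i.e. the sets $\prod_{i=1}^m[c_i-r,c_i+r]$ with $c\in\mathbb{R}^m$, $r>0$. A (closed) degenerate ball in $\ell_\infty^m$ is any set of the form $\prod_{i=1}^m I_i\subset\mathbb{R}^m$, where each $I_i$ is a closed interval unbounded to at least one side, i.e. each $I_i$ is of the form $(-\infty,a]$, $[a,\infty)$ (with $a\in\mathbb{R}$), or $\mathbb{R}$. A family $\mathcal{E}$ of subsets of a set $X$ shatters a finite set $\sigma\subset X$ if for every $\sigma'\subset\sigma$ there is $C\in\mathcal{E}$ with $C\cap\sigma=\sigma'$. The Vapnik-Chervonenkis dimension is $\mathrm{VC\text{-}dim}(\mathcal{E})=\sup\{\#\sigma : \sigma\subset X \text{ is finite and } \mathcal{E} \text{ shatters } \sigma\}$. *)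

theory Defs
  imports Complex_Main "HOL-Library.FuncSet" "HOL-Library.Extended_Nat"
begin

text \<open>
  The dimension varies inside the statement, so the points of \<open>\<real>\<^sup>m\<close> are represented as
  functions on the index set \<open>{0, \<dots>, m - 1}\<close>, extended by \<^const>\<open>undefined\<close>
  outside of it.
\<close>

definition Rvec :: "nat \<Rightarrow> (nat \<Rightarrow> real) set" where
  "Rvec m = {..<m} \<rightarrow>\<^sub>E UNIV"

definition Rvec_zero :: "nat \<Rightarrow> nat \<Rightarrow> real" where
  "Rvec_zero m = (\<lambda>i\<in>{..<m}. 0)"

text \<open>Meaningful only for \<open>m \<ge> 1\<close>, since \<^const>\<open>Max\<close> is unspecified on the empty set.\<close>

definition linf_norm :: "nat \<Rightarrow> (nat \<Rightarrow> real) \<Rightarrow> real" where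
  "linf_norm m x = Max ((\<lambda>i. \<bar>x i\<bar>) ` {..<m})"

definition linf_cball :: "nat \<Rightarrow> (nat \<Rightarrow> real) \<Rightarrow> real \<Rightarrow> (nat \<Rightarrow> real) set" where
  "linf_cball m c r = {x \<in> Rvec m. linf_norm m (\<lambda>i\<in>{..<m}. x i - c i) \<le> r}"

definition linf_cballs :: "nat \<Rightarrow> (nat \<Rightarrow> real) set set" where
  "linf_cballs m = {linf_cball m c r | c r. c \<in> Rvec m \<and> r > 0}"

lemma linf_cball_eq_cube:
  assumes "m \<ge> 1"
  shows "linf_cball m c r = (\<Pi>\<^sub>E i\<in>{..<m}. {c i - r..c i + r})"
proof -
  have ne: "{..<m} \<noteq> {}"
    using assms by (simp add: lessThan_empty_iff)
  have "linf_norm m (\<lambda>i\<in>{..<m}. x i - c i) \<le> r \<longleftrightarrow> (\<forall>i<m. x i \<in> {c i - r..c i + r})" for x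
    using ne by (auto simp: linf_norm_def abs_le_iff algebra_simps)
  then show ?thesis
    by (intro set_eqI) (simp add: linf_cball_def Rvec_def PiE_iff conj_commute Ball_def)
qed

definition halfline_intervals :: "real set set" where
  "halfline_intervals = range atMost \<union> range atLeast \<union> {UNIV}"

definition degenerate_balls :: "nat \<Rightarrow> (nat \<Rightarrow> real) set set" where
  "degenerate_balls m =
    {(\<Pi>\<^sub>E i\<in>{..<m}. J i) | J. \<forall>i<m. J i \<in> halfline_intervals}"

definition degenerate_balls_at_zero :: "nat \<Rightarrow> (nat \<Rightarrow> real) set set" where
  "degenerate_balls_at_zero m = {D \<in> degenerate_balls m. Rvec_zero m \<in> D}"

definition shatters :: "'a set set \<Rightarrow> 'a set \<Rightarrow> bool" where
  "shatters \<E> \<sigma> \<longleftrightarrow> (\<forall>\<sigma>'\<subseteq>\<sigma>. \<exists>C\<in>\<E>. C \<inter> \<sigma> = \<sigma>')"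

definition VC_dim :: "'a set \<Rightarrow> 'a set set \<Rightarrow> enat" where
  "VC_dim X \<E> = Sup {enat (card \<sigma>) | \<sigma>. \<sigma> \<subseteq> X \<and> finite \<sigma> \<and> shatters \<E> \<sigma>}"

end

theory Submission imports Defs begin

text \<open>
  A cube of half-width \<open>R\<close> agrees with a degenerate ball on every set of diameter at most \<open>2 * R\<close>.
  For the lower bound, put a set shattered by degenerate balls at height \<open>0\<close> and add two points far
  above and below the origin: large cubes cut out the points at height \<open>0\<close> as degenerate balls do,
  while their last coordinate controls the two new points. For the upper bound, choose a
  coordinate \<open>k\<close> in which a shattered set is widest, with extreme points \<open>a\<close> and \<open>b\<close>. The
  cubes containing both \<open>a\<close> and \<open>b\<close> are at least as wide as the set in every direction, so on
  the set they act as degenerate balls in the coordinates other than \<open>k\<close>; translate \<open>a\<close> to the origin.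
\<close>

section \<open>Intervals and half-lines on bounded sets of reals\<close>

text \<open>If some point of \<open>S\<close> lies below \<open>c - r\<close>, the width bound keeps
  all of \<open>S\<close> below \<open>c + r\<close>, so the upper end excludes nothing. Otherwise
  the lower end excludes nothing.\<close>

lemma interval_as_halfline:
  fixes c r :: real
  assumes "\<And>s t. s \<in> S \<Longrightarrow> t \<in> S \<Longrightarrow> t - s \<le> 2 * r"
  shows "\<exists>J\<in>halfline_intervals. \<forall>t\<in>S. t \<in> J \<longleftrightarrow> t \<in> {c - r..c + r}"
proof (cases "\<exists>s\<in>S. s < c - r")
  case True
  then obtain s where s: "s \<in> S" "s < c - r" by blast
  have "t \<in> {c - r..} \<longleftrightarrow> t \<in> {c - r..c + r}" if "t \<in> S" for t
    using assms[OF s(1) that] s(2) by auto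
  then show ?thesis
    by (intro bexI[of _ "{c - r..}"]) (auto simp: halfline_intervals_def)
next
  case False
  then have "\<forall>t\<in>S. t \<in> {..c + r} \<longleftrightarrow> t \<in> {c - r..c + r}"
    by force
  then show ?thesis
    by (intro bexI[of _ "{..c + r}"]) (auto simp: halfline_intervals_def)
qed

lemma halfline_as_interval:
  assumes "J \<in> halfline_intervals" "0 \<in> J" "0 \<le> K" "K \<le> R"
  shows "\<exists>c. \<forall>t. \<bar>t\<bar> \<le> K \<longrightarrow> (t \<in> {c - R..c + R} \<longleftrightarrow> t \<in> J)"
proof -
  consider a where "J = {..a}" | a where "J = {a..}" | "J = UNIV"
    using assms(1) by (auto simp: halfline_intervals_def)
  then show ?thesis
  proof cases
    case 1
    \<comment> \<open>Clipping \<open>a\<close> to \<open>K\<close> changes nothing where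
      \<open>\<bar>t\<bar> \<le> K\<close>, and the other end \<open>min a K - 2 * R\<close> is at
      most \<open>- K\<close> because \<open>K \<le> R\<close>. The next case is the mirror
      image.\<close>
    then show ?thesis using assms by (intro exI[of _ "min a K - R"]) auto
  next
    case 2
    then show ?thesis using assms by (intro exI[of _ "max a (- K) + R"]) auto
  next
    case 3
    then show ?thesis using assms by (intro exI[of _ 0]) auto
  qed
qed

section \<open>Cubes and points with one more coordinate\<close>

lemma linf_cballs_Suc:
  "C \<in> linf_cballs (Suc m) \<longleftrightarrow>
    (\<exists>c\<in>Rvec (Suc m). \<exists>r>0. C = (\<Pi>\<^sub>E i\<in>{..<Suc m}. {c i - r..c i + r}))"
  unfolding linf_cballs_def by (auto simp: linf_cball_eq_cube)

lemma Rvec_zero_in_Rvec: "Rvec_zero m \<in> Rvec m"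
  by (simp add: Rvec_def Rvec_zero_def)

text \<open>A point of \<open>Rvec m\<close> is \<open>undefined\<close> at \<open>m\<close>, so
  \<open>x(m := t)\<close> is \<open>x\<close> with \<open>t\<close> appended as last
  coordinate.\<close>

lemma fun_upd_in_PiE_Suc:
  assumes "x \<in> Rvec m"
  shows "x(m := t) \<in> (\<Pi>\<^sub>E i\<in>{..<Suc m}. I i) \<longleftrightarrow> (\<forall>i<m. x i \<in> I i) \<and> t \<in> I m"
proof -
  have "x(m := t) \<in> extensional {..<Suc m}"
    using assms by (auto simp: Rvec_def PiE_def extensional_def)
  then show ?thesis
    unfolding PiE_iff by (auto simp: less_Suc_eq)
qed

lemma fun_upd_in_Rvec: "x \<in> Rvec m \<Longrightarrow> x(m := t) \<in> Rvec (Suc m)"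
  using fun_upd_in_PiE_Suc[of x m t "\<lambda>_. UNIV"] by (simp add: Rvec_def)

lemma fun_upd_eq_iff_Rvec:
  assumes "x \<in> Rvec m" "y \<in> Rvec m"
  shows "x(m := s) = y(m := t) \<longleftrightarrow> x = y \<and> s = t"
proof -
  have "x m = undefined" "y m = undefined"
    using assms by (auto simp: Rvec_def PiE_iff extensional_def)
  then have "x = (x(m := s))(m := undefined)" "y = (y(m := t))(m := undefined)"
    by auto
  then show ?thesis by (metis fun_upd_same)
qed

section \<open>Lower bound: adding two points\<close>

text \<open>All sides of a cube share one half-width, so \<open>R\<close> is fixed first. Each
  centre coordinate can then be chosen separately, and the last one, \<open>t\<close>, stays
  free.\<close>

lemma degenerate_ball_lift_to_cube:
  assumes D: "D \<in> degenerate_balls_at_zero m" and "0 < R" "0 \<le> K" "K \<le> R"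
  shows "\<exists>C\<in>linf_cballs (Suc m). \<forall>x\<in>Rvec m. \<forall>s. (\<forall>i<m. \<bar>x i\<bar> \<le> K) \<longrightarrow>
    (x(m := s) \<in> C \<longleftrightarrow> x \<in> D \<and> s \<in> {t - R..t + R})"
proof -
  obtain J where J: "D = (\<Pi>\<^sub>E i\<in>{..<m}. J i)" "\<forall>i<m. J i \<in> halfline_intervals"
    using D by (auto simp: degenerate_balls_at_zero_def degenerate_balls_def)
  have "\<forall>i<m. 0 \<in> J i"
    using D J(1) by (auto simp: degenerate_balls_at_zero_def Rvec_zero_def PiE_iff)
  then have "\<forall>i. \<exists>c. i < m \<longrightarrow> (\<forall>u. \<bar>u\<bar> \<le> K \<longrightarrow> (u \<in> {c - R..c + R} \<longleftrightarrow> u \<in> J i))"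
    using halfline_as_interval J(2) assms(3,4) by blast
  then obtain c where
    c: "\<And>i u. i < m \<Longrightarrow> \<bar>u\<bar> \<le> K \<Longrightarrow> u \<in> {c i - R..c i + R} \<longleftrightarrow> u \<in> J i"
    by metis
  define c' where "c' = (\<lambda>i\<in>{..<Suc m}. if i < m then c i else t)"
  let ?C = "\<Pi>\<^sub>E i\<in>{..<Suc m}. {c' i - R..c' i + R}"
  have "c' \<in> Rvec (Suc m)"
    by (simp add: c'_def Rvec_def)
  then have "?C \<in> linf_cballs (Suc m)"
    using \<open>0 < R\<close> linf_cballs_Suc by blast
  moreover have "x(m := s) \<in> ?C \<longleftrightarrow> x \<in> D \<and> s \<in> {t - R..t + R}"
    if x: "x \<in> Rvec m" "\<forall>i<m. \<bar>x i\<bar> \<le> K" for x s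
  proof -
    have "x \<in> D \<longleftrightarrow> (\<forall>i<m. x i \<in> J i)"
      using x(1) by (auto simp: J(1) Rvec_def PiE_iff)
    also have "\<dots> \<longleftrightarrow> (\<forall>i<m. x i \<in> {c' i - R..c' i + R})"
      using c x(2) by (simp add: c'_def)
    finally show ?thesis
      by (simp add: fun_upd_in_PiE_Suc[OF x(1)] c'_def)
  qed
  ultimately show ?thesis
    by (intro bexI[of _ ?C] ballI allI impI)
qed

lemma finite_coordinates_bounded:
  fixes \<sigma> :: "(nat \<Rightarrow> real) set"
  assumes "finite \<sigma>"
  obtains K where "1 \<le> K" "\<And>x i. x \<in> \<sigma> \<Longrightarrow> i < m \<Longrightarrow> \<bar>x i\<bar> \<le> K"
proof -
  \<comment> \<open>The extra element 1 covers the case of no points or no coordinates and later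
    makes the half-width of the cubes positive.\<close>
  let ?A = "insert 1 ((\<lambda>(x, i). \<bar>x i\<bar>) ` (\<sigma> \<times> {..<m}))"
  have fin: "finite ?A" using assms by simp
  show thesis
  proof
    show "1 \<le> Max ?A" using fin by (intro Max_ge) auto
    show "\<bar>x i\<bar> \<le> Max ?A" if "x \<in> \<sigma>" "i < m" for x i
      using fin that by (intro Max_ge) force+
  qed
qed

lemma shattered_by_cubes_of_degenerate:
  assumes sub: "\<sigma> \<subseteq> Rvec m" and fin: "finite \<sigma>"
    and shat: "shatters (degenerate_balls_at_zero m) \<sigma>"
  obtains \<rho> where "\<rho> \<subseteq> Rvec (Suc m)" "finite \<rho>" "shatters (linf_cballs (Suc m)) \<rho>"
    "card \<rho> = card \<sigma> + 2"
proof -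
  obtain K where K: "1 \<le> K" "\<And>x i. x \<in> \<sigma> \<Longrightarrow> i < m \<Longrightarrow> \<bar>x i\<bar> \<le> K"
    using finite_coordinates_bounded[OF fin] by blast
  let ?z = "Rvec_zero m"
  define M where "M = K + 1"
  define p q where "p = ?z(m := M)" and "q = ?z(m := - M)"
  define \<rho> where "\<rho> = insert p (insert q ((\<lambda>x. x(m := 0)) ` \<sigma>))"
  have M: "M > 0" using K(1) by (simp add: M_def)
  note upd_eq = fun_upd_eq_iff_Rvec[of _ m]
  have distinct: "p \<noteq> q" "p \<notin> (\<lambda>x. x(m := 0)) ` \<sigma>" "q \<notin> (\<lambda>x. x(m := 0)) ` \<sigma>"
    using M sub by (auto simp: p_def q_def upd_eq Rvec_zero_in_Rvec subset_iff)
  have inj: "inj_on (\<lambda>x. x(m := 0)) \<sigma>"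
    using sub by (intro inj_onI) (auto simp: upd_eq subset_iff)
  show thesis
  proof
    show "\<rho> \<subseteq> Rvec (Suc m)"
      using sub by (auto simp: \<rho>_def p_def q_def intro!: fun_upd_in_Rvec Rvec_zero_in_Rvec)
    show "finite \<rho>" using fin by (simp add: \<rho>_def)
    show "card \<rho> = card \<sigma> + 2"
      using distinct fin by (simp add: \<rho>_def card_image[OF inj])
    show "shatters (linf_cballs (Suc m)) \<rho>"
      unfolding shatters_def
    proof (intro allI impI)
      fix \<tau> assume \<tau>: "\<tau> \<subseteq> \<rho>"
      have "{x \<in> \<sigma>. x(m := 0) \<in> \<tau>} \<subseteq> \<sigma>" by blast
      then obtain D where D: "D \<in> degenerate_balls_at_zero m"
        "D \<inter> \<sigma> = {x \<in> \<sigma>. x(m := 0) \<in> \<tau>}"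
        using shat unfolding shatters_def by blast
      \<comment> \<open>Both \<open>p\<close> and \<open>q\<close> project to the origin, which lies
        in \<open>D\<close>; hence only their heights decide whether the cube contains them.\<close>
      have zD: "?z \<in> D"
        using D(1) by (simp add: degenerate_balls_at_zero_def)
      \<comment> \<open>The heights of \<open>p\<close> and \<open>q\<close> are K + 1 and -(K + 1).
        In the order of the cases, the intervals are [-K-1, K+1], [-K, K+2], [-K-2, K] and
        [-K, K].\<close>
      have "\<exists>R t. K \<le> R \<and> 0 \<in> {t - R..t + R} \<and> (M \<in> {t - R..t + R} \<longleftrightarrow> p \<in> \<tau>)
        \<and> (- M \<in> {t - R..t + R} \<longleftrightarrow> q \<in> \<tau>)"
      proof -
        consider "p \<in> \<tau>" "q \<in> \<tau>" | "p \<in> \<tau>" "q \<notin> \<tau>" | "p \<notin> \<tau>" "q \<in> \<tau>" | "p \<notin> \<tau>" "q \<notin> \<tau>"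
          by blast
        then show ?thesis
        proof cases
          case 1
          then show ?thesis using K(1) by (intro exI[of _ M] exI[of _ 0]) (simp add: M_def)
        next
          case 2
          then show ?thesis using K(1) by (intro exI[of _ M] exI[of _ 1]) (simp add: M_def)
        next
          case 3
          then show ?thesis using K(1) by (intro exI[of _ M] exI[of _ "- 1"]) (simp add: M_def)
        next
          case 4
          then show ?thesis using K(1) by (intro exI[of _ K] exI[of _ 0]) (simp add: M_def)
        qed
      qed
      then obtain R t where R: "K \<le> R" and zero: "0 \<in> {t - R..t + R}"
        and pR: "M \<in> {t - R..t + R} \<longleftrightarrow> p \<in> \<tau>" and qR: "- M \<in> {t - R..t + R} \<longleftrightarrow> q \<in> \<tau>"
        by blast
      obtain C where C: "C \<in> linf_cballs (Suc m)"
        "\<And>x s. x \<in> Rvec m \<Longrightarrow> \<forall>i<m. \<bar>x i\<bar> \<le> K \<Longrightarrow>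
          x(m := s) \<in> C \<longleftrightarrow> x \<in> D \<and> s \<in> {t - R..t + R}"
        using degenerate_ball_lift_to_cube[OF D(1), of R K t] K(1) R by force
      have z: "?z(m := s) \<in> C \<longleftrightarrow> s \<in> {t - R..t + R}" for s
        using C(2)[OF Rvec_zero_in_Rvec, of s] zD K(1) by (simp add: Rvec_zero_def)
      have "x(m := 0) \<in> C \<longleftrightarrow> x(m := 0) \<in> \<tau>" if "x \<in> \<sigma>" for x
        using C(2)[of x 0] that sub K(2) zero D(2) by blast
      moreover have "p \<in> C \<longleftrightarrow> p \<in> \<tau>" "q \<in> C \<longleftrightarrow> q \<in> \<tau>"
        using z pR qR by (simp_all add: p_def q_def)
      ultimately have "\<forall>y\<in>\<rho>. y \<in> C \<longleftrightarrow> y \<in> \<tau>"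
        by (auto simp: \<rho>_def)
      with \<tau> have "C \<inter> \<rho> = \<tau>" by blast
      with C(1) show "\<exists>C\<in>linf_cballs (Suc m). C \<inter> \<rho> = \<tau>" by blast
    qed
  qed
qed

section \<open>Upper bound: removing two points and a widest coordinate\<close>

text \<open>Maximizing over ordered pairs avoids absolute values and fixes the orientation:
  \<open>a\<close> is the lower extreme point, \<open>b\<close> the upper one.\<close>

lemma widest_coordinate:
  fixes \<sigma> :: "(nat \<Rightarrow> real) set"
  assumes "finite \<sigma>" "\<sigma> \<noteq> {}" "0 < n"
  obtains a b k where "a \<in> \<sigma>" "b \<in> \<sigma>" "k < n"
    "\<And>x y i. x \<in> \<sigma> \<Longrightarrow> y \<in> \<sigma> \<Longrightarrow> i < n \<Longrightarrow> y i - x i \<le> b k - a k"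
proof -
  let ?f = "\<lambda>(x, y, i). y i - x i :: real"
  let ?T = "\<sigma> \<times> \<sigma> \<times> {..<n}"
  have fin: "finite (?f ` ?T)" and ne: "?f ` ?T \<noteq> {}" using assms by auto
  obtain a b k where abk: "a \<in> \<sigma>" "b \<in> \<sigma>" "k < n" "Max (?f ` ?T) = b k - a k"
    using Max_in[OF fin ne] by auto
  have "y i - x i \<le> b k - a k" if "x \<in> \<sigma>" "y \<in> \<sigma>" "i < n" for x y i
    unfolding abk(4)[symmetric] using fin that by (intro Max_ge) force+
  with abk show thesis using that by blast
qed

lemma shattered_by_degenerate_of_cubes:
  assumes sub: "\<sigma> \<subseteq> Rvec (Suc m)" and fin: "finite \<sigma>" and two: "2 \<le> card \<sigma>"
    and shat: "shatters (linf_cballs (Suc m)) \<sigma>"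
  obtains \<rho> where "\<rho> \<subseteq> Rvec m" "finite \<rho>" "shatters (degenerate_balls_at_zero m) \<rho>"
    "card \<sigma> = card \<rho> + 2"
proof -
  have "\<sigma> \<noteq> {}" using two by auto
  obtain a b k where ab: "a \<in> \<sigma>" "b \<in> \<sigma>" and k: "k < Suc m"
    and wide: "\<And>x y i. x \<in> \<sigma> \<Longrightarrow> y \<in> \<sigma> \<Longrightarrow> i < Suc m \<Longrightarrow> y i - x i \<le> b k - a k"
    by (rule widest_coordinate[OF fin \<open>\<sigma> \<noteq> {}\<close> zero_less_Suc[of m]]) blast
  \<comment> \<open>If \<open>a = b\<close>, the greatest width is 0 and \<open>\<sigma>\<close> has
    at most one point.\<close>
  have "a \<noteq> b"
  proof
    assume "a = b"
    then have "x i = y i" if "x \<in> \<sigma>" "y \<in> \<sigma>" "i < Suc m" for x y i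
      using wide[of x y i] wide[of y x i] that by simp
    moreover have "\<sigma> \<subseteq> {..<Suc m} \<rightarrow>\<^sub>E UNIV"
      using sub by (simp add: Rvec_def)
    ultimately have "x = y" if "x \<in> \<sigma>" "y \<in> \<sigma>" for x y
      using that by (intro PiE_ext[of x "{..<Suc m}" "\<lambda>_. UNIV" y]) auto
    then have "card \<sigma> \<le> Suc 0"
      using fin by (simp add: card_le_Suc0_iff_eq)
    with two show False by simp
  qed
  \<comment> \<open>On \<open>{..<m}\<close>, \<open>f\<close> enumerates the coordinates other than
    \<open>k\<close>: the last one takes the place of \<open>k\<close>, and \<open>f\<close> is the
    identity if \<open>k = m\<close>.\<close>
  define f where "f i = (if i = k then m else i)" for i
  have f: "{..<Suc m} = insert k (f ` {..<m})"
    using k by (auto simp: f_def image_iff less_Suc_eq)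
  define proj where "proj x = (\<lambda>i\<in>{..<m}. x (f i) - a (f i))" for x :: "nat \<Rightarrow> real"
  let ?S = "\<sigma> - {a, b}"
  \<comment> \<open>Stated for sets of points before projection, so that injectivity of
    \<open>proj\<close> on \<open>?S\<close> can be deduced from it.\<close>
  have key: "\<exists>D\<in>degenerate_balls_at_zero m. \<forall>x\<in>?S. proj x \<in> D \<longleftrightarrow> x \<in> \<tau>"
    if \<tau>: "\<tau> \<subseteq> ?S" for \<tau>
  proof -
    have "\<tau> \<union> {a, b} \<subseteq> \<sigma>" using \<tau> ab by blast
    then obtain C where C: "C \<in> linf_cballs (Suc m)" "C \<inter> \<sigma> = \<tau> \<union> {a, b}"
      using shat unfolding shatters_def by blast
    obtain c r where cube: "C = (\<Pi>\<^sub>E i\<in>{..<Suc m}. {c i - r..c i + r})"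
      using C(1) linf_cballs_Suc by blast
    have abC: "a \<in> C" "b \<in> C" using C(2) by auto
    \<comment> \<open>Hence \<open>b k - a k \<le> 2 * r\<close>, which bounds the width of
      \<open>\<sigma>\<close> in every coordinate.\<close>
    have Ik: "c k - r \<le> a k" "b k \<le> c k + r"
      using abC k by (auto simp: cube PiE_iff)
    have "\<exists>J\<in>halfline_intervals. \<forall>t\<in>(\<lambda>x. x (f i) - a (f i)) ` \<sigma>.
        t \<in> J \<longleftrightarrow> t \<in> {c (f i) - a (f i) - r..c (f i) - a (f i) + r}" if "i < m" for i
    proof (rule interval_as_halfline)
      fix s t assume "s \<in> (\<lambda>x. x (f i) - a (f i)) ` \<sigma>" "t \<in> (\<lambda>x. x (f i) - a (f i)) ` \<sigma>"
      moreover have "f i < Suc m" using f that by auto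
      ultimately have "t - s \<le> b k - a k" using wide by fastforce
      then show "t - s \<le> 2 * r" using Ik by simp
    qed
    then have "\<forall>i. \<exists>J. i < m \<longrightarrow> J \<in> halfline_intervals \<and> (\<forall>t\<in>(\<lambda>x. x (f i) - a (f i)) ` \<sigma>.
        t \<in> J \<longleftrightarrow> t \<in> {c (f i) - a (f i) - r..c (f i) - a (f i) + r})"
      by blast
    then obtain J where J: "\<And>i. i < m \<Longrightarrow> J i \<in> halfline_intervals"
      "\<And>i x. i < m \<Longrightarrow> x \<in> \<sigma> \<Longrightarrow> x (f i) - a (f i) \<in> J i \<longleftrightarrow>
        x (f i) - a (f i) \<in> {c (f i) - a (f i) - r..c (f i) - a (f i) + r}"
      by (metis (no_types, lifting) imageI)
    define D where "D = (\<Pi>\<^sub>E i\<in>{..<m}. J i)"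
    have proj_D: "proj x \<in> D \<longleftrightarrow> x \<in> C" if x: "x \<in> \<sigma>" for x
    proof -
      have "x k \<in> {c k - r..c k + r}"
        using wide[OF x ab(2) k] wide[OF ab(1) x k] Ik by simp
      moreover have "x \<in> extensional {..<Suc m}"
        using x sub by (auto simp: Rvec_def PiE_def)
      ultimately have "x \<in> C \<longleftrightarrow> (\<forall>i<m. x (f i) \<in> {c (f i) - r..c (f i) + r})"
        unfolding cube f PiE_iff by auto
      also have "\<dots> \<longleftrightarrow> (\<forall>i<m. x (f i) - a (f i) \<in> J i)"
        using J(2)[OF _ x] by auto
      also have "\<dots> \<longleftrightarrow> proj x \<in> D"
        by (auto simp: D_def proj_def PiE_iff)
      finally show ?thesis by simp
    qed
    have "proj a = Rvec_zero m"
      by (auto simp: proj_def Rvec_zero_def)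
    then have "Rvec_zero m \<in> D"
      using proj_D[OF ab(1)] abC(1) by simp
    then have "D \<in> degenerate_balls_at_zero m"
      using J(1) by (auto simp: degenerate_balls_at_zero_def degenerate_balls_def D_def)
    moreover have "\<forall>x\<in>?S. proj x \<in> D \<longleftrightarrow> x \<in> \<tau>"
      using proj_D C(2) by blast
    ultimately show ?thesis by blast
  qed
  \<comment> \<open>Shattering separates the projections: the ball that \<open>key\<close> gives for
    \<open>{x}\<close> contains no \<open>proj y\<close> with \<open>y\<close> another point of
    \<open>?S\<close>.\<close>
  have inj: "inj_on proj ?S"
  proof (rule inj_onI)
    fix x y assume xy: "x \<in> ?S" "y \<in> ?S" "proj x = proj y"
    then obtain D where "\<forall>u\<in>?S. proj u \<in> D \<longleftrightarrow> u \<in> {x}"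
      using key[of "{x}"] by blast
    with xy show "x = y" by (metis singleton_iff)
  qed
  show thesis
  proof (rule that[of "proj ` ?S"])
    show "proj ` ?S \<subseteq> Rvec m" by (simp add: proj_def Rvec_def image_subset_iff)
    show "finite (proj ` ?S)" using fin by simp
    show "card \<sigma> = card (proj ` ?S) + 2"
      using two ab \<open>a \<noteq> b\<close> by (simp add: card_image[OF inj] card_Diff_subset)
    show "shatters (degenerate_balls_at_zero m) (proj ` ?S)"
      unfolding shatters_def
    proof (intro allI impI)
      fix \<tau> assume \<tau>: "\<tau> \<subseteq> proj ` ?S"
      have "{x \<in> ?S. proj x \<in> \<tau>} \<subseteq> ?S" by blast
      from key[OF this] obtain D where D: "D \<in> degenerate_balls_at_zero m"
        "\<forall>x\<in>?S. proj x \<in> D \<longleftrightarrow> proj x \<in> \<tau>" by blast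
      then have "D \<inter> proj ` ?S = \<tau>" using \<tau> by blast
      with D(1) show "\<exists>D\<in>degenerate_balls_at_zero m. D \<inter> proj ` ?S = \<tau>" by blast
    qed
  qed
qed

section \<open>Suprema of cardinalities and the equality of dimensions\<close>

lemma card_le_VC_dim:
  "\<sigma> \<subseteq> X \<Longrightarrow> finite \<sigma> \<Longrightarrow> shatters \<E> \<sigma> \<Longrightarrow> enat (card \<sigma>) \<le> VC_dim X \<E>"
  unfolding VC_dim_def by (rule Sup_upper) blast

lemma VC_dim_le:
  assumes "\<And>\<sigma>. \<sigma> \<subseteq> X \<Longrightarrow> finite \<sigma> \<Longrightarrow> shatters \<E> \<sigma> \<Longrightarrow> enat (card \<sigma>) \<le> v"
  shows "VC_dim X \<E> \<le> v"
  unfolding VC_dim_def by (rule Sup_least) (use assms in blast)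

text \<open>Non-emptiness of the family makes it shatter the empty set; without it the supremum is
  taken over the empty set and the left-hand side is just \<open>k\<close>.\<close>

lemma VC_dim_plus_le:
  assumes "\<E> \<noteq> {}"
    and "\<And>\<sigma>. \<sigma> \<subseteq> X \<Longrightarrow> finite \<sigma> \<Longrightarrow> shatters \<E> \<sigma> \<Longrightarrow> enat (card \<sigma> + k) \<le> v"
  shows "VC_dim X \<E> + enat k \<le> v"
proof (cases v)
  case (enat n)
  have "shatters \<E> {}" using assms(1) by (auto simp: shatters_def)
  from assms(2)[OF _ _ this] have "k \<le> n" by (simp add: enat)
  have "card \<sigma> \<le> n - k" if "\<sigma> \<subseteq> X" "finite \<sigma>" "shatters \<E> \<sigma>" for \<sigma>
    using assms(2)[OF that] by (simp add: enat)
  then have "VC_dim X \<E> \<le> enat (n - k)"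
    by (intro VC_dim_le) simp
  then have "VC_dim X \<E> + enat k \<le> enat (n - k) + enat k"
    by (rule add_right_mono)
  \<comment> \<open>Because \<open>k \<le> n\<close>, the subtraction \<open>n - k\<close> is not
    truncated and adding \<open>k\<close> restores \<open>n\<close>.\<close>
  with \<open>k \<le> n\<close> show ?thesis by (simp add: enat)
qed simp

lemma degenerate_balls_at_zero_nonempty: "degenerate_balls_at_zero m \<noteq> {}"
proof -
  have "Rvec m \<in> degenerate_balls_at_zero m"
    using Rvec_zero_in_Rvec[of m]
    by (auto simp: degenerate_balls_at_zero_def degenerate_balls_def Rvec_def
        halfline_intervals_def intro!: exI[of _ "\<lambda>_. UNIV"])
  then show ?thesis by blast
qed

theorem theoremB:
  fixes d :: nat
  assumes "d \<ge> 2"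
  shows "VC_dim (Rvec d) (linf_cballs d)
       = VC_dim (Rvec (d - 1)) (degenerate_balls_at_zero (d - 1)) + 2"
proof -
  define m where "m = d - 1"
  have d: "d = Suc m" using assms by (simp add: m_def)
  let ?V = "VC_dim (Rvec m) (degenerate_balls_at_zero m)"
  have two: "(2 :: enat) = enat 2" by (simp add: numeral_eq_enat)
  have "VC_dim (Rvec (Suc m)) (linf_cballs (Suc m)) \<le> ?V + enat 2"
  proof (rule VC_dim_le)
    fix \<sigma> assume \<sigma>: "\<sigma> \<subseteq> Rvec (Suc m)" "finite \<sigma>" "shatters (linf_cballs (Suc m)) \<sigma>"
    show "enat (card \<sigma>) \<le> ?V + enat 2"
    proof (cases "2 \<le> card \<sigma>")
      case True
      obtain \<rho> where "\<rho> \<subseteq> Rvec m" "finite \<rho>" "shatters (degenerate_balls_at_zero m) \<rho>"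
        and card: "card \<sigma> = card \<rho> + 2"
        using shattered_by_degenerate_of_cubes[OF \<sigma>(1,2) True \<sigma>(3)] by blast
      then have "enat (card \<rho>) + enat 2 \<le> ?V + enat 2"
        by (intro add_right_mono card_le_VC_dim)
      then show ?thesis by (simp add: card)
    next
      case False
      \<comment> \<open>With fewer than two points there is no pair to remove, but the summand 2
        alone suffices.\<close>
      then have "enat (card \<sigma>) \<le> enat 2" by simp
      also have "\<dots> \<le> ?V + enat 2" by simp
      finally show ?thesis .
    qed
  qed
  moreover have "?V + enat 2 \<le> VC_dim (Rvec (Suc m)) (linf_cballs (Suc m))"
  proof (rule VC_dim_plus_le[OF degenerate_balls_at_zero_nonempty])
    fix \<sigma> assume "\<sigma> \<subseteq> Rvec m" "finite \<sigma>" "shatters (degenerate_balls_at_zero m) \<sigma>"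
    then obtain \<rho> where "\<rho> \<subseteq> Rvec (Suc m)" "finite \<rho>" "shatters (linf_cballs (Suc m)) \<rho>"
      and card: "card \<rho> = card \<sigma> + 2"
      using shattered_by_cubes_of_degenerate by blast
    then show "enat (card \<sigma> + 2) \<le> VC_dim (Rvec (Suc m)) (linf_cballs (Suc m))"
      unfolding card[symmetric] by (intro card_le_VC_dim)
  qed
  ultimately show ?thesis
    unfolding d two by simp
qed

end
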